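(* Let $K\subset\mathbb{R}^d$ be a finite geometric simplicial complex with vertex set $X$, and let $U$ be a connected subset of $\Sigma(X)$. Then for each fixed $x\in X$ the lower stars $K^{(x,v)}$ are the same for all $v\in U$; denote this common set of simplices by $K^{(x,U)}$. Moreover, for all $v\in U$, $$\operatorname{ECT}(K)(v)=\sum_{x\in X}\mathbf{1}_{[v\cdot x,\infty)}\,\chi\big(K^{(x,U)}\big)$$ as functions on $\mathbb{R}$.
   Context: A finite geometric simplicial complex $K$ in $\mathbb{R}^d$ is a finite set of geometric simplices (convex hulls of affinely independent points) closed under taking faces and such that any two simplices intersect in the empty set or a common face; $K$ also denotes the union of its simplices. $\Sigma(X)=S^{d-1}\setminus W(X)$, where $W(X)=\bigcup_{x\ne y\in X}\{v\in\mathbb{R}^d: x\cdot v=y\cdot v\}$. $K^{(x,v)}=\{\Delta\in K: x\text{ is a vertex of }\Delta,\ x\cdot v=\max_{y\in\Delta}y\cdot v\}$ is the lower star of $x$ for the height function in direction $v$. For such a set of simplices, $\chi(K^{(x,U)})=\sum_{\Delta\in K^{(x,U)}}(-1)^{\dim\Delta}$. $\operatorname{ECT}(K)(v)$ is the Euler curve $t\mapsto\chi(\{y\in K: y\cdot v\le t\})$, $\chi$ being the Euler characteristic. *)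

theory Defs
  imports "HOL-Analysis.Analysis" "HOL-Homology.Homology"
begin

(* The library's simplicial_complex regards {} as a (-1)-dimensional simplex and a face of
   every polytope, so it forces {} into every nonempty complex.  Inserting {} here lets K
   contain the empty simplex or not; nothing below depends on whether it does. *)
definition geometric_complex :: "'a::euclidean_space set set \<Rightarrow> bool" where
  "geometric_complex K \<longleftrightarrow> simplicial_complex (insert {} K)"

(* The extreme points of the convex hull of an affinely independent set are its generators,
   i.e. the vertices of the simplex. *)
definition vertex_set :: "'a::euclidean_space set set \<Rightarrow> 'a set" where
  "vertex_set K = {x. \<exists>\<Delta>\<in>K. x extreme_point_of \<Delta>}"

definition tie_directions :: "'a::euclidean_space set \<Rightarrow> 'a set" where
  "tie_directions X = (\<Union>x\<in>X. \<Union>y\<in>X - {x}. {v. x \<bullet> v = y \<bullet> v})"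

definition generic_directions :: "'a::euclidean_space set \<Rightarrow> 'a set" where
  "generic_directions X = sphere 0 1 - tie_directions X"

(* Since x is itself a point of \<Delta>, the last conjunct says that x \<bullet> v is the maximum of
   y \<bullet> v over y in \<Delta>. *)
definition lower_star :: "'a::euclidean_space set set \<Rightarrow> 'a \<Rightarrow> 'a \<Rightarrow> 'a set set" where
  "lower_star K x v = {\<Delta>\<in>K. x extreme_point_of \<Delta> \<and> (\<forall>y\<in>\<Delta>. y \<bullet> v \<le> x \<bullet> v)}"

(* Meaningful only if U is nonempty and the lower star of x is constant on U. *)
definition lower_star_on :: "'a::euclidean_space set set \<Rightarrow> 'a \<Rightarrow> 'a set \<Rightarrow> 'a set set" where
  "lower_star_on K x U = (THE S. \<forall>v\<in>U. lower_star K x v = S)"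

(* Intended for finite sets of nonempty simplices: nat would send the dimension -1 of the
   empty simplex to 0.  Lower stars never contain the empty simplex. *)
definition simplex_euler_char :: "'a::euclidean_space set set \<Rightarrow> int" where
  "simplex_euler_char S = (\<Sum>\<Delta>\<in>S. (-1) ^ nat (aff_dim \<Delta>))"

definition int_independent :: "('a, 'b) monoid_scheme \<Rightarrow> 'a set \<Rightarrow> bool" where
  "int_independent G A \<longleftrightarrow> finite A \<and> A \<subseteq> carrier G \<and>
     (\<forall>c::'a \<Rightarrow> int. (\<Otimes>\<^bsub>G\<^esub>a\<in>A. a [^]\<^bsub>G\<^esub> c a) = \<one>\<^bsub>G\<^esub> \<longrightarrow> (\<forall>a\<in>A. c a = 0))"

(* The torsion-free rank of an abelian group G (written multiplicatively), for G of finite rank. *)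
definition abelian_rank :: "('a, 'b) monoid_scheme \<Rightarrow> nat" where
  "abelian_rank G = Sup {card A | A. int_independent G A}"

definition betti :: "nat \<Rightarrow> 'a topology \<Rightarrow> nat" where
  "betti p T = abelian_rank (homology_group (int p) T)"

(* The Euler characteristic of a topological space whose singular homology has finite total
   rank, such as a compact polyhedron. *)
definition euler_char :: "'a topology \<Rightarrow> int" where
  "euler_char T = (\<Sum>p | betti p T \<noteq> 0. (-1) ^ p * int (betti p T))"

definition ECT :: "'a::euclidean_space set set \<Rightarrow> 'a \<Rightarrow> real \<Rightarrow> int" where
  "ECT K v = (\<lambda>t. euler_char (top_of_set {y \<in> \<Union>K. y \<bullet> v \<le> t}))"

end

theory Submission
  imports Defs
begin

text \<open>
  The part of \<open>K\<close> below height \<open>t\<close> is covered by the open stars of the vertices \<open>x\<close> with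
  \<open>x \<bullet> v \<le> t\<close>. An intersection of such stars, indexed by a nonempty set \<open>F\<close>, is empty unless
  \<open>F\<close> spans a simplex of \<open>K\<close>, and otherwise it is starlike with respect to any relatively interior
  point of that simplex. By Mayer--Vietoris for open sets, inclusion-exclusion over this cover turns
  the Euler characteristic into the alternating count of the simplices lying below height \<open>t\<close>.
  In a generic direction each of these has a unique highest vertex, which sorts them into lower
  stars. Membership in a lower star depends only on the signs of \<open>(y - x) \<bullet> v\<close> for vertices
  \<open>x \<noteq> y\<close>, and these cannot change on a connected set of generic directions.
\<close>

section \<open>Ranks of abelian groups\<close>

text \<open>\<open>Sup\<close> of a set of naturals is informative only if the set is bounded, so
  boundedness is tracked separately. Working inside a subset of the carrier lets kernels and images
  be treated without making them groups of their own.\<close>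

definition rank_bounded :: "('a, 'b) monoid_scheme \<Rightarrow> 'a set \<Rightarrow> bool" where
  "rank_bounded G S \<longleftrightarrow> (\<exists>n. \<forall>A. A \<subseteq> S \<and> int_independent G A \<longrightarrow> card A \<le> n)"

definition subset_rank :: "('a, 'b) monoid_scheme \<Rightarrow> 'a set \<Rightarrow> nat" where
  "subset_rank G S = Sup {card A | A. A \<subseteq> S \<and> int_independent G A}"

text \<open>Indexed version for images under maps not yet known to be injective: a repeated value
  counts once per index.\<close>

definition int_independent_family ::
  "('a, 'b) monoid_scheme \<Rightarrow> 'i set \<Rightarrow> ('i \<Rightarrow> 'a) \<Rightarrow> bool" where
  "int_independent_family G I e \<longleftrightarrow> finite I \<and> e \<in> I \<rightarrow> carrier G \<and>
     (\<forall>c::'i \<Rightarrow> int. (\<Otimes>\<^bsub>G\<^esub>i\<in>I. e i [^]\<^bsub>G\<^esub> c i) = \<one>\<^bsub>G\<^esub> \<longrightarrow> (\<forall>i\<in>I. c i = 0))"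

lemma abelian_rank_eq_subset_rank: "abelian_rank G = subset_rank G (carrier G)"
  unfolding abelian_rank_def subset_rank_def
  by (rule arg_cong[where f = Sup]) (auto simp: int_independent_def)

lemma rank_boundedI:
  "(\<And>A. A \<subseteq> S \<Longrightarrow> int_independent G A \<Longrightarrow> card A \<le> n) \<Longrightarrow> rank_bounded G S"
  unfolding rank_bounded_def by blast

lemma int_independent_empty: "comm_group G \<Longrightarrow> int_independent G {}"
  by (simp add: int_independent_def)

lemma card_le_subset_rank:
  assumes "rank_bounded G S" "A \<subseteq> S" "int_independent G A"
  shows "card A \<le> subset_rank G S"
  unfolding subset_rank_def
proof (rule cSup_upper)
  show "bdd_above {card A |A. A \<subseteq> S \<and> int_independent G A}"
    using assms(1) by (auto simp: rank_bounded_def bdd_above_def)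
qed (use assms in auto)

lemma subset_rank_attained:
  assumes "comm_group G" "rank_bounded G S"
  obtains A where "A \<subseteq> S" "int_independent G A" "card A = subset_rank G S"
proof -
  let ?M = "{card A |A. A \<subseteq> S \<and> int_independent G A}"
  have "?M \<noteq> {}" using int_independent_empty[OF assms(1)] by blast
  moreover obtain n where "?M \<subseteq> {..n}" using assms(2) by (auto simp: rank_bounded_def)
  then have "finite ?M" by (rule finite_subset) simp
  ultimately have "Max ?M \<in> ?M" by (rule Max_in[rotated])
  then show ?thesis using that \<open>?M \<noteq> {}\<close> \<open>finite ?M\<close>
    by (auto simp: subset_rank_def cSup_eq_Max)
qed

text \<open>A repeated value would give a nontrivial relation with coefficients 1 and -1 at the two
  indices; once \<open>e\<close> is injective, products over \<open>I\<close> and over its image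
  agree.\<close>

lemma int_independent_familyD:
  fixes G (structure)
  assumes "comm_group G" and ind: "int_independent_family G I e"
  shows "inj_on e I" "int_independent G (e ` I)"
proof -
  interpret comm_group G by fact
  have fin: "finite I" and eG: "e \<in> I \<rightarrow> carrier G"
    and zero: "\<And>c::_ \<Rightarrow> int. (\<Otimes>i\<in>I. e i [^] c i) = \<one> \<Longrightarrow> \<forall>i\<in>I. c i = 0"
    using ind by (auto simp: int_independent_family_def)
  show inj: "inj_on e I"
  proof (rule inj_onI, rule ccontr)
    fix i j assume ij: "i \<in> I" "j \<in> I" "e i = e j" "i \<noteq> j"
    define c :: "_ \<Rightarrow> int" where "c = (\<lambda>k. if k = i then 1 else if k = j then -1 else 0)"
    have ei: "e i \<in> carrier G" "e j \<in> carrier G" using eG ij by auto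
    have "(\<Otimes>k\<in>I. e k [^] c k) = (\<Otimes>k\<in>{i,j}. e k [^] c k)"
      by (rule finprod_mono_neutral_cong_right) (use fin eG ij in \<open>auto simp: c_def\<close>)
    also have "\<dots> = e i [^] c i \<otimes> e j [^] c j"
      using ij ei by simp
    also have "\<dots> = \<one>"
      using ij ei by (simp add: c_def int_pow_neg)
    finally have "c i = 0" using zero ij by blast
    then show False by (simp add: c_def)
  qed
  show "int_independent G (e ` I)"
    unfolding int_independent_def
  proof (intro conjI allI impI ballI)
    fix c :: "_ \<Rightarrow> int" and a
    assume 1: "(\<Otimes>a\<in>e ` I. a [^] c a) = \<one>" and "a \<in> e ` I"
    have "(\<Otimes>a\<in>e ` I. a [^] c a) = (\<Otimes>i\<in>I. e i [^] c (e i))"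
      by (rule finprod_reindex) (use eG inj in auto)
    with 1 zero[of "c \<circ> e"] \<open>a \<in> e ` I\<close> show "c a = 0" by auto
  qed (use fin eG in auto)
qed

section \<open>Ranks of kernels and images\<close>

lemma hom_finprod:
  assumes "comm_group G" "comm_group H" "f \<in> hom G H" "e \<in> I \<rightarrow> carrier G"
  shows "f (\<Otimes>\<^bsub>G\<^esub>i\<in>I. e i) = (\<Otimes>\<^bsub>H\<^esub>i\<in>I. f (e i))"
proof -
  interpret G: comm_group G by fact
  interpret H: comm_group H by fact
  interpret group_hom G H f using assms(3) by unfold_locales
  show ?thesis using assms(4)
    by (induction I rule: infinite_finite_induct) (auto simp: Pi_iff)
qed

text \<open>Written additively, this interchanges two finite sums. It turns a relation among
  combinations of \<open>C\<close> into a relation among the elements of \<open>C\<close>.\<close>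

lemma finprod_int_pow_combine:
  fixes G (structure)
  assumes "comm_group G" "finite C" "C \<subseteq> carrier G" "finite J"
  shows "(\<Otimes>\<^bsub>G\<^esub>j\<in>J. (\<Otimes>\<^bsub>G\<^esub>x\<in>C. x [^]\<^bsub>G\<^esub> D j x) [^]\<^bsub>G\<^esub> m j)
    = (\<Otimes>\<^bsub>G\<^esub>x\<in>C. x [^]\<^bsub>G\<^esub> (\<Sum>j\<in>J. D j x * m j :: int))"
proof -
  interpret comm_group G by fact
  have pow: "(\<Otimes>x\<in>C. x [^] d x) [^] n = (\<Otimes>x\<in>C. x [^] (d x * n))" for d and n :: int
    using assms(2,3)
    by (induction C rule: finite_induct) (auto simp: Pi_iff int_pow_distrib int_pow_pow subset_iff)
  show ?thesis using assms(4)
  proof (induction J rule: finite_induct)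
    case (insert j J)
    have "(\<Otimes>x\<in>C. x [^] (D j x * m j)) \<otimes> (\<Otimes>x\<in>C. x [^] (\<Sum>j\<in>J. D j x * m j))
      = (\<Otimes>x\<in>C. x [^] (D j x * m j) \<otimes> x [^] (\<Sum>j\<in>J. D j x * m j))"
      using assms(3) by (intro finprod_multf[symmetric]) auto
    also have "\<dots> = (\<Otimes>x\<in>C. x [^] (D j x * m j + (\<Sum>j\<in>J. D j x * m j)))"
      by (rule finprod_cong') (use assms(3) in \<open>auto simp: int_pow_mult subset_iff\<close>)
    moreover have cl: "(\<Otimes>x\<in>C. x [^] D k x) [^] m k \<in> carrier G" for k
      using assms(3) by (intro int_pow_closed finprod_closed) auto
    ultimately show ?case using insert by (simp add: pow)
  qed simp
qed

text \<open>The union of \<open>A\<close> with chosen preimages of \<open>B\<close> is independent: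
  applying \<open>f\<close> to a relation kills the part over \<open>A\<close>, so the coefficients
  over \<open>B\<close> vanish, and what remains is a relation on \<open>A\<close>.\<close>

lemma int_independent_lift:
  assumes G: "comm_group G" and H: "comm_group H" and f: "f \<in> hom G H"
    and A: "A \<subseteq> kernel G H f" "int_independent G A"
    and B: "B \<subseteq> f ` carrier G" "int_independent H B"
  shows "\<exists>C. int_independent G C \<and> card C = card A + card B"
proof -
  interpret G: comm_group G by fact
  interpret H: comm_group H by fact
  interpret group_hom G H f using f by unfold_locales
  define g where "g = inv_into (carrier G) f"
  have g: "g b \<in> carrier G" "f (g b) = b" if "b \<in> B" for b
    using that B(1) by (auto simp: g_def inv_into_into f_inv_into_f subset_iff)
  have fin: "finite A" "finite B" "A \<subseteq> carrier G" "B \<subseteq> carrier H"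
    using A B by (auto simp: int_independent_def)
  have inj: "inj_on g B" by (metis g(2) inj_onI)
  have disj: "A \<inter> g ` B = {}"
  proof (rule ccontr)
    assume "A \<inter> g ` B \<noteq> {}"
    then obtain b where b: "b \<in> B" "g b \<in> A" by auto
    then have "b = \<one>\<^bsub>H\<^esub>" using A(1) g(2)[of b] by (auto simp: kernel_def)
    \<comment> \<open>The identity cannot belong to an independent set, since coefficient 1 on it
      alone is a nontrivial relation.\<close>
    then have "(\<Otimes>\<^bsub>H\<^esub>a\<in>B. a [^]\<^bsub>H\<^esub> (if a = b then 1 else 0::int)) = \<one>\<^bsub>H\<^esub>"
      by (intro H.finprod_one_eqI) auto
    then have "\<forall>a\<in>B. (if a = b then 1 else 0::int) = 0"
      using B(2) unfolding int_independent_def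
      by (elim conjE allE[where x = "\<lambda>a. if a = b then 1 else 0"]) blast
    then show False using b(1) by auto
  qed
  have "int_independent G (A \<union> g ` B)"
    unfolding int_independent_def
  proof (intro conjI allI impI)
    fix c :: "_ \<Rightarrow> int"
    let ?P = "\<lambda>S. (\<Otimes>\<^bsub>G\<^esub>a\<in>S. a [^]\<^bsub>G\<^esub> c a)"
    assume 1: "?P (A \<union> g ` B) = \<one>\<^bsub>G\<^esub>"
    have split: "?P (A \<union> g ` B) = ?P A \<otimes>\<^bsub>G\<^esub> ?P (g ` B)"
      by (rule G.finprod_Un_disjoint) (use fin g disj in auto)
    have "f (?P A) = (\<Otimes>\<^bsub>H\<^esub>a\<in>A. f (a [^]\<^bsub>G\<^esub> c a))"
      by (rule hom_finprod[OF G H f]) (use fin in auto)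
    also have "\<dots> = \<one>\<^bsub>H\<^esub>"
      by (rule H.finprod_one_eqI) (use A(1) in \<open>auto simp: kernel_def hom_int_pow subset_iff\<close>)
    finally have fA: "f (?P A) = \<one>\<^bsub>H\<^esub>" .
    have cl: "?P A \<in> carrier G" "?P (g ` B) \<in> carrier G"
      by (rule G.finprod_closed; use fin g in auto)+
    have "\<one>\<^bsub>H\<^esub> = f (?P (g ` B))"
      using 1 split fA cl by (metis H.l_one hom_closed hom_mult hom_one)
    also have "?P (g ` B) = (\<Otimes>\<^bsub>G\<^esub>b\<in>B. g b [^]\<^bsub>G\<^esub> c (g b))"
      by (rule G.finprod_reindex) (use g inj in auto)
    also have "f \<dots> = (\<Otimes>\<^bsub>H\<^esub>b\<in>B. f (g b [^]\<^bsub>G\<^esub> c (g b)))"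
      by (rule hom_finprod[OF G H f]) (use g in auto)
    also have "\<dots> = (\<Otimes>\<^bsub>H\<^esub>b\<in>B. b [^]\<^bsub>H\<^esub> c (g b))"
      by (rule H.finprod_cong') (use g fin in \<open>auto simp: hom_int_pow\<close>)
    finally have "\<forall>b\<in>B. c (g b) = 0"
      using B(2) by (auto simp: int_independent_def dest: spec[of _ "\<lambda>b. c (g b)"])
    then have cB: "\<forall>a\<in>g ` B. c a = 0" by blast
    then have "?P (g ` B) = \<one>\<^bsub>G\<^esub>" by (intro G.finprod_one_eqI) auto
    then have "?P A = \<one>\<^bsub>G\<^esub>" using 1 split cl by simp
    then have "\<forall>a\<in>A. c a = 0" using A(2) by (auto simp: int_independent_def)
    with cB show "\<forall>a\<in>A \<union> g ` B. c a = 0" by blast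
  qed (use fin g in auto)
  moreover have "card (A \<union> g ` B) = card A + card B"
    using disj fin inj by (simp add: card_Un_disjoint card_image)
  ultimately show ?thesis by blast
qed

text \<open>
  Choose \<^term>\<open>C1\<close> maximal in \<^term>\<open>C\<close> such that its image is an independent family. Every
  \<^term>\<open>c\<close> outside \<^term>\<open>C1\<close> then has a relation modulo the kernel in which its own coefficient is
  nonzero, and the kernel elements obtained from these relations are independent.
\<close>
lemma int_independent_split:
  assumes G: "comm_group G" and H: "comm_group H" and f: "f \<in> hom G H"
    and C: "int_independent G C"
  shows "\<exists>A B. A \<subseteq> kernel G H f \<and> int_independent G A \<and> B \<subseteq> f ` carrier G \<and> int_independent H B
    \<and> card C = card A + card B"
proof -
  interpret G: comm_group G by fact
  interpret H: comm_group H by fact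
  interpret group_hom G H f using f by unfold_locales
  have fin: "finite C" "C \<subseteq> carrier G" using C by (auto simp: int_independent_def)
  have "finite {D. D \<subseteq> C \<and> int_independent_family H D f}"
    using fin by simp
  moreover have "{} \<in> {D. D \<subseteq> C \<and> int_independent_family H D f}"
    by (auto simp: int_independent_family_def)
  ultimately obtain C1 where C1: "C1 \<subseteq> C" "int_independent_family H C1 f"
    and max: "\<And>D. D \<subseteq> C \<Longrightarrow> int_independent_family H D f \<Longrightarrow> C1 \<subseteq> D \<Longrightarrow> D = C1"
    using finite_has_maximal[of "{D. D \<subseteq> C \<and> int_independent_family H D f}"]
    by (metis (no_types, lifting) empty_iff mem_Collect_eq)
  have fin1: "finite C1" using C1(1) fin finite_subset by blast
  define J where "J = C - C1"
  have "\<exists>d::_ \<Rightarrow> int. (\<forall>x\<in>C - insert c C1. d x = 0) \<and> d c \<noteq> 0 \<and>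
      (\<Otimes>\<^bsub>G\<^esub>x\<in>C. x [^]\<^bsub>G\<^esub> d x) \<in> kernel G H f" if "c \<in> J" for c
  proof -
    have c: "c \<in> C" "c \<notin> C1" using that by (auto simp: J_def)
    have "\<not> int_independent_family H (insert c C1) f"
      using max[of "insert c C1"] c C1(1) by blast
    then obtain d :: "_ \<Rightarrow> int" where d: "(\<Otimes>\<^bsub>H\<^esub>x\<in>insert c C1. f x [^]\<^bsub>H\<^esub> d x) = \<one>\<^bsub>H\<^esub>"
      and nz: "\<exists>x\<in>insert c C1. d x \<noteq> 0"
      using fin1 fin c C1(1) by (auto simp: int_independent_family_def)
    \<comment> \<open>Otherwise the relation would involve only \<open>C1\<close>, whose image is an
      independent family.\<close>
    have dc: "d c \<noteq> 0"
    proof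
      assume 0: "d c = 0"
      have "(\<Otimes>\<^bsub>H\<^esub>x\<in>insert c C1. f x [^]\<^bsub>H\<^esub> d x)
          = f c [^]\<^bsub>H\<^esub> d c \<otimes>\<^bsub>H\<^esub> (\<Otimes>\<^bsub>H\<^esub>x\<in>C1. f x [^]\<^bsub>H\<^esub> d x)"
        using fin1 fin c C1(1) by (intro H.finprod_insert) auto
      moreover have "(\<Otimes>\<^bsub>H\<^esub>x\<in>C1. f x [^]\<^bsub>H\<^esub> d x) \<in> carrier H"
        using fin C1(1) by (intro H.finprod_closed) auto
      ultimately have "(\<Otimes>\<^bsub>H\<^esub>x\<in>C1. f x [^]\<^bsub>H\<^esub> d x) = \<one>\<^bsub>H\<^esub>"
        using d 0 by simp
      then have "\<forall>x\<in>C1. d x = 0"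
        using C1(2) by (auto simp: int_independent_family_def)
      with 0 nz show False by auto
    qed
    \<comment> \<open>Extension by zero lets all relations share the index set
      \<open>C\<close>.\<close>
    define d' where "d' = (\<lambda>x. if x \<in> insert c C1 then d x else 0)"
    have cl: "(\<Otimes>\<^bsub>G\<^esub>x\<in>C. x [^]\<^bsub>G\<^esub> d' x) \<in> carrier G"
      using fin by (intro G.finprod_closed) auto
    have "f (\<Otimes>\<^bsub>G\<^esub>x\<in>C. x [^]\<^bsub>G\<^esub> d' x) = (\<Otimes>\<^bsub>H\<^esub>x\<in>C. f (x [^]\<^bsub>G\<^esub> d' x))"
      by (rule hom_finprod[OF G H f]) (use fin in auto)
    also have "\<dots> = (\<Otimes>\<^bsub>H\<^esub>x\<in>insert c C1. f x [^]\<^bsub>H\<^esub> d x)"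
      by (rule H.finprod_mono_neutral_cong_right)
        (use fin c C1(1) in \<open>auto simp: d'_def hom_int_pow subset_iff\<close>)
    finally have "(\<Otimes>\<^bsub>G\<^esub>x\<in>C. x [^]\<^bsub>G\<^esub> d' x) \<in> kernel G H f"
      using cl d by (simp add: kernel_def)
    then show ?thesis using dc by (intro exI[of _ d']) (auto simp: d'_def)
  qed
  then obtain D :: "_ \<Rightarrow> _ \<Rightarrow> int" where
    D0: "\<And>c x. c \<in> J \<Longrightarrow> x \<in> C - insert c C1 \<Longrightarrow> D c x = 0"
    and Dc: "\<And>c. c \<in> J \<Longrightarrow> D c c \<noteq> 0"
    and Dk: "\<And>c. c \<in> J \<Longrightarrow> (\<Otimes>\<^bsub>G\<^esub>x\<in>C. x [^]\<^bsub>G\<^esub> D c x) \<in> kernel G H f"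
    by metis
  define k where "k = (\<lambda>c. \<Otimes>\<^bsub>G\<^esub>x\<in>C. x [^]\<^bsub>G\<^esub> D c x)"
  have finJ: "finite J" using fin by (simp add: J_def)
  have k: "int_independent_family G J k"
    unfolding int_independent_family_def
  proof (intro conjI allI impI ballI finJ)
    show "k \<in> J \<rightarrow> carrier G" using Dk by (auto simp: k_def kernel_def)
    fix m :: "_ \<Rightarrow> int" and c
    assume 1: "(\<Otimes>\<^bsub>G\<^esub>j\<in>J. k j [^]\<^bsub>G\<^esub> m j) = \<one>\<^bsub>G\<^esub>" and c: "c \<in> J"
    then have "(\<Otimes>\<^bsub>G\<^esub>x\<in>C. x [^]\<^bsub>G\<^esub> (\<Sum>j\<in>J. D j x * m j)) = \<one>\<^bsub>G\<^esub>"
      unfolding k_def by (subst (asm) finprod_int_pow_combine[OF G fin finJ])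
    then have "\<forall>x\<in>C. (\<Sum>j\<in>J. D j x * m j) = 0"
      using C unfolding int_independent_def
      by (elim conjE allE[where x = "\<lambda>x. \<Sum>j\<in>J. D j x * m j"]) blast
    then have "(\<Sum>j\<in>J. D j c * m j) = 0"
      using c by (simp add: J_def)
    \<comment> \<open>For \<open>j\<close> in \<open>J\<close> other than \<open>c\<close>,
      \<open>D j\<close> vanishes at \<open>c\<close>: the matrix \<open>D\<close> is diagonal on
      \<open>J\<close>, with nonzero diagonal entries.\<close>
    moreover have "(\<Sum>j\<in>J. D j c * m j) = (\<Sum>j\<in>{c}. D j c * m j)"
      by (rule sum.mono_neutral_right) (use finJ c D0 in \<open>auto simp: J_def\<close>)
    ultimately show "m c = 0" using Dc c by simp
  qed
  note k' = int_independent_familyD[OF G k] and f' = int_independent_familyD[OF H C1(2)]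
  have "card C = card (k ` J) + card (f ` C1)"
    using k'(1) f'(1) C1(1) fin fin1
    by (simp add: card_image J_def card_Diff_subset card_mono)
  moreover have "k ` J \<subseteq> kernel G H f" using Dk by (auto simp: k_def)
  moreover have "f ` C1 \<subseteq> f ` carrier G" using C1(1) fin by blast
  ultimately show ?thesis using k'(2) f'(2) by blast
qed

text \<open>Lifting, with nothing taken from the kernel, bounds the image; splitting adds the two
  bounds for the converse.\<close>

lemma rank_bounded_kernel_image:
  assumes G: "comm_group G" and H: "comm_group H" and f: "f \<in> hom G H"
  shows "rank_bounded G (carrier G) \<longleftrightarrow>
    rank_bounded G (kernel G H f) \<and> rank_bounded H (f ` carrier G)"
proof (intro iffI conjI)
  assume "rank_bounded G (carrier G)"
  then obtain n where "\<forall>C. C \<subseteq> carrier G \<and> int_independent G C \<longrightarrow> card C \<le> n"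
    unfolding rank_bounded_def ..
  then have n: "card C \<le> n" if "int_independent G C" for C
    using that by (simp add: int_independent_def)
  show "rank_bounded G (kernel G H f)" by (rule rank_boundedI) (rule n)
  have "card B \<le> n" if "B \<subseteq> f ` carrier G" "int_independent H B" for B
    using int_independent_lift[OF G H f empty_subsetI int_independent_empty[OF G] that] n
    by (metis add_0 card.empty)
  then show "rank_bounded H (f ` carrier G)" by (rule rank_boundedI)
next
  assume "rank_bounded G (kernel G H f) \<and> rank_bounded H (f ` carrier G)"
  then obtain m n where
    "\<forall>A. A \<subseteq> kernel G H f \<and> int_independent G A \<longrightarrow> card A \<le> m"
    "\<forall>B. B \<subseteq> f ` carrier G \<and> int_independent H B \<longrightarrow> card B \<le> n"
    unfolding rank_bounded_def by (elim conjE exE)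
  then have "card C \<le> m + n" if "int_independent G C" for C
    using int_independent_split[OF G H f that] by (metis add_mono)
  then show "rank_bounded G (carrier G)" by (rule rank_boundedI)
qed

text \<open>Rank-nullity for abelian groups. Splitting a largest independent set of \<open>G\<close>
  gives one inequality, and lifting largest independent sets of the kernel and the image gives the
  other.\<close>

lemma rank_kernel_image:
  assumes G: "comm_group G" and H: "comm_group H" and f: "f \<in> hom G H"
    and fin: "rank_bounded G (carrier G)"
  shows "abelian_rank G = subset_rank G (kernel G H f) + subset_rank H (f ` carrier G)"
proof -
  note kb = conjunct1[OF rank_bounded_kernel_image[THEN iffD1, OF G H f fin]]
    and ib = conjunct2[OF rank_bounded_kernel_image[THEN iffD1, OF G H f fin]]
  show ?thesis unfolding abelian_rank_eq_subset_rank
  proof (rule antisym)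
    obtain C where C: "int_independent G C" "card C = subset_rank G (carrier G)"
      using subset_rank_attained[OF G fin] by blast
    then show "subset_rank G (carrier G)
        \<le> subset_rank G (kernel G H f) + subset_rank H (f ` carrier G)"
      using int_independent_split[OF G H f C(1)] card_le_subset_rank[OF kb] card_le_subset_rank[OF ib]
      by (metis add_mono)
    obtain A where A: "A \<subseteq> kernel G H f" "int_independent G A" "card A = subset_rank G (kernel G H f)"
      using subset_rank_attained[OF G kb] by blast
    obtain B where B: "B \<subseteq> f ` carrier G" "int_independent H B" "card B = subset_rank H (f ` carrier G)"
      using subset_rank_attained[OF H ib] by blast
    obtain C' where "int_independent G C'" "card C' = card A + card B"
      using int_independent_lift[OF G H f A(1,2) B(1,2)] by blast
    then show "subset_rank G (kernel G H f) + subset_rank H (f ` carrier G)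
        \<le> subset_rank G (carrier G)"
      using card_le_subset_rank[OF fin] A B by (metis int_independent_def)
  qed
qed

section \<open>Ranks of trivial groups, isomorphic groups and the integers\<close>

lemma subset_rank_one:
  fixes G (structure)
  assumes "comm_group G"
  shows "rank_bounded G {\<one>\<^bsub>G\<^esub>}" "subset_rank G {\<one>\<^bsub>G\<^esub>} = 0"
proof -
  interpret comm_group G by fact
  have A: "card A \<le> 0" if "A \<subseteq> {\<one>}" "int_independent G A" for A
  proof (rule ccontr)
    assume "\<not> card A \<le> 0"
    with that(1) have A: "A = {\<one>}" by (metis card.empty le_zero_eq subset_singletonD)
    then have "(\<Otimes>a\<in>A. a [^] (1::int)) = \<one>" by (intro finprod_one_eqI) auto
    then have "\<forall>a\<in>A. (1::int) = 0"
      using that(2) unfolding int_independent_def by (elim conjE allE[where x = "\<lambda>_. 1"]) blast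
    with A show False by simp
  qed
  then show b: "rank_bounded G {\<one>}" by (rule rank_boundedI)
  show "subset_rank G {\<one>} = 0"
    using subset_rank_attained[OF assms b] A by (metis le_zero_eq)
qed

lemma trivial_group_rank:
  assumes "comm_group G" "trivial_group G"
  shows "rank_bounded G (carrier G)" "abelian_rank G = 0"
  using assms subset_rank_one[OF assms(1)]
  by (simp_all add: trivial_group_def abelian_rank_eq_subset_rank)

lemma iso_rank:
  assumes G: "comm_group G" and H: "comm_group H" and f: "f \<in> iso G H"
  shows "rank_bounded G (carrier G) \<longleftrightarrow> rank_bounded H (carrier H)"
    "rank_bounded G (carrier G) \<Longrightarrow> abelian_rank G = abelian_rank H"
proof -
  interpret G: comm_group G by fact
  interpret H: comm_group H by fact
  have h: "f \<in> hom G H" and im: "f ` carrier G = carrier H" and inj: "inj_on f (carrier G)"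
    using f by (auto simp: iso_def bij_betw_def)
  interpret group_hom G H f using h by unfold_locales
  have ker: "kernel G H f = {\<one>\<^bsub>G\<^esub>}"
    using inj by (simp add: inj_iff_trivial_ker)
  show "rank_bounded G (carrier G) \<longleftrightarrow> rank_bounded H (carrier H)"
    using rank_bounded_kernel_image[OF G H h] ker im subset_rank_one[OF G] by simp
  show "rank_bounded G (carrier G) \<Longrightarrow> abelian_rank G = abelian_rank H"
    using rank_kernel_image[OF G H h] ker im subset_rank_one[OF G]
    by (simp add: abelian_rank_eq_subset_rank)
qed

lemma integer_group_rank:
  "rank_bounded integer_group (carrier integer_group)" "abelian_rank integer_group = 1"
proof -
  interpret comm_group integer_group by (rule abelian_integer_group)
  have prod: "(\<Otimes>\<^bsub>integer_group\<^esub>a\<in>A. f a) = sum f A" if "finite A" for A and f :: "int \<Rightarrow> int"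
    using that by (induction A rule: finite_induct) auto
  have le: "card A \<le> 1" if A: "int_independent integer_group A" for A
  proof (rule ccontr)
    assume "\<not> card A \<le> 1"
    moreover have fin: "finite A" using A by (simp add: int_independent_def)
    ultimately obtain a b where ab: "a \<in> A" "b \<in> A" "a \<noteq> b"
      by (metis card_le_Suc0_iff_eq One_nat_def)
    \<comment> \<open>This encodes \<open>b * a - a * b = 0\<close>, which is nontrivial because
      distinct integers are not both zero.\<close>
    define c where "c = (\<lambda>x. if x = a then b else if x = b then - a else 0)"
    have "(\<Sum>x\<in>A. c x * x) = (\<Sum>x\<in>{a,b}. c x * x)"
      by (rule sum.mono_neutral_right) (use fin ab in \<open>auto simp: c_def\<close>)
    also have "\<dots> = 0" using ab by (simp add: c_def)
    finally have "(\<Otimes>\<^bsub>integer_group\<^esub>x\<in>A. x [^]\<^bsub>integer_group\<^esub> c x) = \<one>\<^bsub>integer_group\<^esub>"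
      using fin by (simp add: prod)
    then have "c a = 0" "c b = 0" using A ab unfolding int_independent_def by blast+
    with ab show False by (auto simp: c_def)
  qed
  then show b: "rank_bounded integer_group (carrier integer_group)"
    by (intro rank_boundedI)
  have "int_independent integer_group {1}" by (auto simp: int_independent_def)
  then have "1 \<le> abelian_rank integer_group"
    using card_le_subset_rank[OF b, of "{1}"] by (simp add: abelian_rank_eq_subset_rank)
  moreover obtain A where "int_independent integer_group A"
      "card A = abelian_rank integer_group"
    using subset_rank_attained[OF abelian_integer_group b]
    by (metis abelian_rank_eq_subset_rank)
  ultimately show "abelian_rank integer_group = 1" using le by fastforce
qed

section \<open>Euler characteristic and open covers\<close>

definition alternating_sum :: "(nat \<Rightarrow> nat) \<Rightarrow> int" where
  "alternating_sum r = (\<Sum>p | r p \<noteq> 0. (-1) ^ p * int (r p))"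

text \<open>Excludes both default values that could enter \<open>relative_euler_char\<close>:
  \<open>Sup\<close> of an unbounded set and a sum over an infinite support. Absolute homology is
  the case where \<open>S\<close> is empty.\<close>

definition finite_homology :: "'a topology \<Rightarrow> 'a set \<Rightarrow> bool" where
  "finite_homology X S \<longleftrightarrow>
     (\<forall>p::nat. rank_bounded (relative_homology_group p X S) (carrier (relative_homology_group p X S))) \<and>
     finite {p::nat. abelian_rank (relative_homology_group p X S) \<noteq> 0}"

definition relative_euler_char :: "'a topology \<Rightarrow> 'a set \<Rightarrow> int" where
  "relative_euler_char X S = alternating_sum (\<lambda>p. abelian_rank (relative_homology_group p X S))"

lemma euler_char_eq_relative: "euler_char T = relative_euler_char T {}"
  by (simp add: euler_char_def relative_euler_char_def alternating_sum_def betti_def)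

lemma finite_support_bound:
  fixes r :: "nat \<Rightarrow> nat"
  assumes "finite {p. r p \<noteq> 0}"
  shows "\<exists>N. \<forall>p\<ge>N. r p = 0"
proof -
  obtain N where N: "\<forall>p\<in>{p. r p \<noteq> 0}. p < N"
    using assms finite_nat_set_iff_bounded by blast
  have "r p = 0" if "p \<ge> N" for p
    using bspec[OF N, of p] that by (cases "r p = 0") simp_all
  then show ?thesis by blast
qed

lemma alternating_sum_bounded:
  assumes "\<And>p. p \<ge> N \<Longrightarrow> r p = 0"
  shows "alternating_sum r = (\<Sum>p<N. (-1) ^ p * int (r p))"
proof -
  have "{p. r p \<noteq> 0} \<subseteq> {..<N}"
  proof
    fix p assume "p \<in> {p. r p \<noteq> 0}"
    then show "p \<in> {..<N}" using assms[of p] by (cases "p < N") simp_all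
  qed
  then show ?thesis
    unfolding alternating_sum_def by (intro sum.mono_neutral_left) auto
qed

lemma alternating_sum_add:
  assumes "finite {p. f p \<noteq> 0}" "finite {p. g p \<noteq> 0}"
  shows "alternating_sum (\<lambda>p. f p + g p) = alternating_sum f + alternating_sum g"
proof -
  obtain M where M: "\<forall>p\<ge>M. f p = 0" using finite_support_bound[OF assms(1)] ..
  obtain N where N: "\<forall>p\<ge>N. g p = 0" using finite_support_bound[OF assms(2)] ..
  show ?thesis
    using alternating_sum_bounded[of "max M N" f] alternating_sum_bounded[of "max M N" g]
      alternating_sum_bounded[of "max M N" "\<lambda>p. f p + g p"] M N
    by (simp add: sum.distrib algebra_simps)
qed

text \<open>Moving each term down one degree flips its sign, and \<open>c 0 = 0\<close> ensures that
  no term is lost.\<close>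

lemma alternating_sum_shift:
  assumes "finite {p. c p \<noteq> 0}" "c 0 = 0"
  shows "alternating_sum (\<lambda>p. c (Suc p)) = - alternating_sum c"
proof -
  obtain N where N: "\<forall>p\<ge>N. c p = 0" using finite_support_bound[OF assms(1)] ..
  show ?thesis
    using alternating_sum_bounded[of N "\<lambda>p. c (Suc p)"] alternating_sum_bounded[of "Suc N" c] N assms(2)
    by (simp add: sum.lessThan_Suc_shift sum_negf del: sum.lessThan_Suc)
qed

text \<open>
  In the long exact sequence of a pair, \<^term>\<open>a\<close> and \<^term>\<open>b\<close> are the ranks of the maps into
  degree \<^term>\<open>p\<close> absolute and relative homology, and \<^term>\<open>c\<close> is the rank of the boundary map out
  of degree \<^term>\<open>p\<close>.
\<close>
lemma alternating_sum_exact: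
  fixes a b c :: "nat \<Rightarrow> nat"
  assumes "finite {p. a p \<noteq> 0}" "finite {p. b p \<noteq> 0}" "finite {p. c p \<noteq> 0}" "c 0 = 0"
  shows "alternating_sum (\<lambda>p. a p + b p) =
    alternating_sum (\<lambda>p. c (Suc p) + a p) + alternating_sum (\<lambda>p. b p + c p)"
proof -
  have "finite {p. c (Suc p) \<noteq> 0}"
    using finite_vimageI[OF assms(3) inj_Suc] by (simp add: vimage_def)
  \<comment> \<open>The two contributions of \<open>c\<close> sit one degree apart and therefore
    cancel.\<close>
  then show ?thesis
    using assms by (simp add: alternating_sum_add alternating_sum_shift)
qed

text \<open>Rank-nullity for the three maps \<open>i\<close>, \<open>j\<close>, \<open>d\<close> of
  the long exact sequence writes the ranks of the subspace, the space and the pair as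
  \<open>c (Suc p) + a p\<close>, \<open>a p + b p\<close> and \<open>b p + c p\<close>, where
  \<open>a\<close>, \<open>b\<close>, \<open>c\<close> are the ranks of the images.\<close>

lemma finite_homology_pair:
  assumes A: "finite_homology (subtopology X S) {}"
  shows "finite_homology X {} \<longleftrightarrow> finite_homology X S"
    and "finite_homology X {} \<Longrightarrow>
      relative_euler_char X {} = relative_euler_char (subtopology X S) {} + relative_euler_char X S"
proof -
  define HA where "HA = (\<lambda>p. homology_group p (subtopology X S))"
  define HX where "HX = (\<lambda>p. homology_group p X)"
  define HR where "HR = (\<lambda>p. relative_homology_group p X S)"
  define i where "i = (\<lambda>p. hom_induced p (subtopology X S) {} X {} id)"
  define j where "j = (\<lambda>p. hom_induced p X {} X S id)"
  define d where "d = (\<lambda>p. hom_boundary p X S)"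
  have eqs: "homology_group p (subtopology X S) = HA p" "homology_group p X = HX p"
    "relative_homology_group p X S = HR p" for p
    by (simp_all add: HA_def HX_def HR_def)
  have cg: "comm_group (HA p)" "comm_group (HX p)" "comm_group (HR p)" for p
    by (simp_all add: HA_def HX_def HR_def)
  have hom: "i p \<in> hom (HA p) (HX p)" "j p \<in> hom (HX p) (HR p)"
    "d p \<in> hom (HR p) (HA (p - 1))" for p
    by (simp_all add: i_def j_def d_def HA_def HX_def HR_def hom_induced_hom hom_boundary_hom)
  have ker_j: "kernel (HX p) (HR p) (j p) = i p ` carrier (HA p)" for p
    using homology_exactness_axiom_3[of p X S] by (simp add: i_def j_def HA_def HX_def HR_def)
  have ker_d: "kernel (HR p) (HA (p - 1)) (d p) = j p ` carrier (HX p)" for p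
    using homology_exactness_axiom_1[of p X S] by (simp add: d_def j_def HA_def HX_def HR_def)
  have ker_i: "kernel (HA p) (HX p) (i p) = d (1 + p) ` carrier (HR (1 + p))" for p
    using homology_exactness_axiom_2[of "1 + p" X S] by (simp add: d_def i_def HA_def HX_def HR_def)
  define a where "a = (\<lambda>p::nat. subset_rank (HX p) (i p ` carrier (HA p)))"
  define b where "b = (\<lambda>p::nat. subset_rank (HR p) (j p ` carrier (HX p)))"
  define c where "c = (\<lambda>p::nat. subset_rank (HA (int p - 1)) (d p ` carrier (HR p)))"
  define ba where "ba = (\<lambda>p::nat. rank_bounded (HX p) (i p ` carrier (HA p)))"
  define bb where "bb = (\<lambda>p::nat. rank_bounded (HR p) (j p ` carrier (HX p)))"
  define bc where "bc = (\<lambda>p::nat. rank_bounded (HA (int p - 1)) (d p ` carrier (HR p)))"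
  have BA: "rank_bounded (HA p) (carrier (HA p)) \<longleftrightarrow> bc (Suc p) \<and> ba p" for p :: nat
    using rank_bounded_kernel_image[OF cg(1,2) hom(1), of p] by (simp add: ba_def bc_def ker_i)
  have BX: "rank_bounded (HX p) (carrier (HX p)) \<longleftrightarrow> ba p \<and> bb p" for p :: nat
    using rank_bounded_kernel_image[OF cg(2,3) hom(2), of p] by (simp add: ba_def bb_def ker_j)
  have BR: "rank_bounded (HR p) (carrier (HR p)) \<longleftrightarrow> bb p \<and> bc p" for p :: nat
    using rank_bounded_kernel_image[OF cg(3,1) hom(3), of p] by (simp add: bb_def bc_def ker_d)
  have RA: "abelian_rank (HA p) = c (Suc p) + a p" if "bc (Suc p)" "ba p" for p :: nat
    using rank_kernel_image[OF cg(1,2) hom(1), of p] BA that by (simp add: a_def c_def ker_i)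
  have RX: "abelian_rank (HX p) = a p + b p" if "ba p" "bb p" for p :: nat
    using rank_kernel_image[OF cg(2,3) hom(2), of p] BX that by (simp add: a_def b_def ker_j)
  have RR: "abelian_rank (HR p) = b p + c p" if "bb p" "bc p" for p :: nat
    using rank_kernel_image[OF cg(3,1) hom(3), of p] BR that by (simp add: b_def c_def ker_d)
  \<comment> \<open>The boundary map out of degree 0 lands in degree -1, where homology is trivial.
    This is the end of the sequence at which the telescoping needs \<open>c 0 = 0\<close>.\<close>
  have "d 0 ` carrier (HR 0) = {\<one>\<^bsub>HA (-1)\<^esub>}"
  proof -
    have "carrier (HA (-1)) = {\<one>\<^bsub>HA (-1)\<^esub>}"
      using trivial_homology_group[of "-1" "subtopology X S"]
      unfolding HA_def trivial_group_def by simp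
    moreover have "d 0 ` carrier (HR 0) \<subseteq> carrier (HA (-1))"
      using hom(3)[of 0] by (auto simp: hom_def)
    moreover have "carrier (HR 0) \<noteq> {}"
      using group.is_monoid[OF group_relative_homology_group, THEN monoid.one_closed]
      unfolding HR_def by fast
    ultimately show ?thesis by blast
  qed
  then have c0: "bc 0" "c 0 = 0"
    using subset_rank_one[OF cg(1)[of "-1"]] by (simp_all add: bc_def c_def)
  have fhA: "\<And>p. bc (Suc p) \<and> ba p" "finite {p. c (Suc p) + a p \<noteq> 0}"
    using A BA RA unfolding finite_homology_def eqs by simp_all
  have bc: "bc p" for p using c0 fhA(1) by (cases p) auto
  have ba: "ba p" for p using fhA(1) by blast
  have fin_a: "finite {p. a p \<noteq> 0}"
    by (rule finite_subset[OF _ fhA(2)]) auto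
  have "finite (insert 0 (Suc ` {p. c (Suc p) + a p \<noteq> 0}))" using fhA(2) by blast
  \<comment> \<open>The shifted sequence says nothing about degree 0, so that degree is added by
    hand.\<close>
  moreover have "{p. c p \<noteq> 0} \<subseteq> insert 0 (Suc ` {p. c (Suc p) + a p \<noteq> 0})"
  proof
    fix p assume "p \<in> {p. c p \<noteq> 0}"
    then show "p \<in> insert 0 (Suc ` {p. c (Suc p) + a p \<noteq> 0})" by (cases p) auto
  qed
  ultimately have fin_c: "finite {p. c p \<noteq> 0}" by (rule finite_subset[rotated])
  \<comment> \<open>Finiteness for the subspace already controls \<open>a\<close> and
    \<open>c\<close>, so for the space and for the pair only the conditions on \<open>b\<close>
    remain.\<close>
  have X_iff: "finite_homology X {} \<longleftrightarrow> (\<forall>p. bb p) \<and> finite {p. b p \<noteq> 0}"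
  proof -
    have "finite {p. a p + b p \<noteq> 0} \<longleftrightarrow> finite {p. b p \<noteq> 0}"
      using fin_a by (auto simp: Collect_disj_eq)
    then show ?thesis unfolding finite_homology_def eqs
      using BX RX ba by auto
  qed
  have R_iff: "finite_homology X S \<longleftrightarrow> (\<forall>p. bb p) \<and> finite {p. b p \<noteq> 0}"
  proof -
    have "finite {p. b p + c p \<noteq> 0} \<longleftrightarrow> finite {p. b p \<noteq> 0}"
      using fin_c by (auto simp: Collect_disj_eq)
    then show ?thesis unfolding finite_homology_def eqs
      using BR RR bc by auto
  qed
  show "finite_homology X {} \<longleftrightarrow> finite_homology X S" using X_iff R_iff by simp
  assume "finite_homology X {}"
  then have "bb p" "finite {p. b p \<noteq> 0}" for p using X_iff by auto
  moreover from this have "(\<lambda>p. abelian_rank (HX (int p))) = (\<lambda>p. a p + b p)"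
    "(\<lambda>p. abelian_rank (HA (int p))) = (\<lambda>p. c (Suc p) + a p)"
    "(\<lambda>p. abelian_rank (HR (int p))) = (\<lambda>p. b p + c p)"
    using RX RA RR ba bc by auto
  ultimately show "relative_euler_char X {} =
      relative_euler_char (subtopology X S) {} + relative_euler_char X S"
    unfolding relative_euler_char_def eqs
    using alternating_sum_exact[of a b c] fin_a fin_c c0 by simp
qed

section \<open>Isomorphism invariance, contractible spaces and the empty space\<close>

lemma iso_finite_homology:
  assumes "\<And>p::nat. relative_homology_group p X S \<cong> relative_homology_group p Y T"
    and fin: "finite_homology X S"
  shows "finite_homology Y T" "relative_euler_char Y T = relative_euler_char X S"
proof -
  have "rank_bounded (relative_homology_group p Y T) (carrier (relative_homology_group p Y T)) \<and>
    abelian_rank (relative_homology_group p Y T) = abelian_rank (relative_homology_group p X S)"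
    for p :: nat
  proof -
    obtain f where "f \<in> iso (relative_homology_group p X S) (relative_homology_group p Y T)"
      using assms(1)[of p] unfolding is_iso_def by blast
    from iso_rank[OF abelian_relative_homology_group abelian_relative_homology_group this]
    show ?thesis using fin unfolding finite_homology_def by simp
  qed
  with fin show "finite_homology Y T" "relative_euler_char Y T = relative_euler_char X S"
    by (simp_all add: finite_homology_def relative_euler_char_def)
qed

text \<open>The space is homotopy equivalent to a point, whose homology vanishes in positive degrees
  and is the group of integers in degree 0.\<close>

lemma finite_homology_contractible:
  assumes "contractible_space X" "topspace X \<noteq> {}"
  shows "finite_homology X {}" "relative_euler_char X {} = 1"
proof -
  obtain a where a: "a \<in> topspace X" "X homotopy_equivalent_space (subtopology X {a})"
    using assms by (auto simp: contractible_eq_homotopy_equivalent_singleton_subtopology)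
  define P where "P = subtopology X {a}"
  have top: "topspace P = {a}" using a(1) by (auto simp: P_def)
  have iso: "homology_group p P \<cong> homology_group p X" for p
    using a(2) homotopy_equivalent_space_imp_isomorphic_homology_groups homotopy_equivalent_space_sym
    unfolding P_def by blast
  have pos: "rank_bounded (homology_group (int p) P) (carrier (homology_group (int p) P))"
    "abelian_rank (homology_group (int p) P) = 0" if "p \<noteq> 0" for p :: nat
    using trivial_group_rank[OF abelian_homology_group homology_dimension_axiom[OF top]] that by auto
  obtain f where "f \<in> iso (homology_group 0 P) integer_group"
    using homology_coefficients[OF top] unfolding is_iso_def by (metis ex_in_conv)
  note f = iso_rank[OF abelian_homology_group abelian_integer_group this]
  have zero: "rank_bounded (homology_group 0 P) (carrier (homology_group 0 P))"
    "abelian_rank (homology_group 0 P) = 1"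
    using f integer_group_rank by auto
  have rank: "abelian_rank (homology_group (int p) P) = (if p = 0 then 1 else 0)" for p
    using zero pos by auto
  have "rank_bounded (homology_group (int p) P) (carrier (homology_group (int p) P))" for p
    using zero pos by (cases "p = 0") auto
  then have fin: "finite_homology P {}"
    by (auto simp: finite_homology_def rank)
  have one: "relative_euler_char P {} = 1"
    by (simp add: relative_euler_char_def alternating_sum_def rank)
  show "finite_homology X {}" "relative_euler_char X {} = 1"
    using iso_finite_homology[OF iso fin] one by auto
qed

lemma finite_homology_empty:
  assumes "topspace X = {}"
  shows "finite_homology X {}" "relative_euler_char X {} = 0"
  using trivial_group_rank[OF abelian_homology_group trivial_homology_group_empty[OF assms]]
  by (simp_all add: finite_homology_def relative_euler_char_def alternating_sum_def)

section \<open>Open unions and good covers\<close>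

lemma relative_homology_excision_open:
  assumes "openin Z A" "openin Z B"
  shows "relative_homology_group p (subtopology Z B) (A \<inter> B)
    \<cong> relative_homology_group p (subtopology Z (A \<union> B)) A"
proof -
  define Y where "Y = subtopology Z (A \<union> B)"
  have sub: "A \<subseteq> topspace Z" "B \<subseteq> topspace Z" using assms by (auto dest: openin_subset)
  then have top: "topspace Y = A \<union> B" by (auto simp: Y_def)
  have open_Y: "openin Y A" "openin Y B"
    using assms by (simp_all add: Y_def openin_subtopology_Un openin_open_subtopology openin_Un)
  \<comment> \<open>Since \<open>B\<close> is open, \<open>A - B\<close> is closed in
    \<open>A \<union> B\<close>; it lies in the open set \<open>A\<close> and can be excised, which
    leaves the pair of \<open>B\<close> and \<open>A \<inter> B\<close>.\<close>
  have "closedin Y (A - B)"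
    using closedin_diff[OF closedin_topspace open_Y(2)] top by (simp add: Un_Diff)
  then have "Y closure_of (A - B) \<subseteq> Y interior_of A"
    using open_Y(1) by (auto simp: closure_of_closedin interior_of_openin)
  then have "hom_induced p (subtopology Y (A \<union> B - (A - B))) (A - (A - B)) (subtopology Y (A \<union> B)) A id
    \<in> iso (relative_homology_group p (subtopology Y (A \<union> B - (A - B))) (A - (A - B)))
          (relative_homology_group p (subtopology Y (A \<union> B)) A)"
    by (rule homology_excision_axiom) auto
  moreover have "A \<union> B - (A - B) = B" "A - (A - B) = A \<inter> B" by auto
  moreover have "subtopology Y B = subtopology Z B" "subtopology Y (A \<union> B) = Y"
    by (simp_all add: Y_def subtopology_subtopology Int_absorb1)
  ultimately show ?thesis unfolding Y_def[symmetric] is_iso_def by auto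
qed

text \<open>Excision identifies the relative homology of the pairs \<open>(B, A \<inter> B)\<close>
  and \<open>(A \<union> B, A)\<close>; comparing the additivity formulas of the two pairs
  eliminates the relative term.\<close>

lemma euler_char_open_Un:
  assumes AB: "openin Z A" "openin Z B"
    and fin: "finite_homology (subtopology Z A) {}" "finite_homology (subtopology Z B) {}"
      "finite_homology (subtopology Z (A \<inter> B)) {}"
  shows "finite_homology (subtopology Z (A \<union> B)) {}"
    and "euler_char (subtopology Z (A \<union> B)) + euler_char (subtopology Z (A \<inter> B))
      = euler_char (subtopology Z A) + euler_char (subtopology Z B)"
proof -
  have eqs: "subtopology (subtopology Z B) (A \<inter> B) = subtopology Z (A \<inter> B)"
    "subtopology (subtopology Z (A \<union> B)) A = subtopology Z A"
    by (simp_all add: subtopology_subtopology Int_absorb1 Int_absorb2 inf_commute)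
  note B = finite_homology_pair[of "subtopology Z B" "A \<inter> B", unfolded eqs, OF fin(3)]
    and U = finite_homology_pair[of "subtopology Z (A \<union> B)" A, unfolded eqs, OF fin(1)]
  have "finite_homology (subtopology Z B) (A \<inter> B)" using B(1) fin(2) by simp
  note ex = iso_finite_homology[OF relative_homology_excision_open[OF AB] this]
  show "finite_homology (subtopology Z (A \<union> B)) {}" using U(1) ex(1) by simp
  then show "euler_char (subtopology Z (A \<union> B)) + euler_char (subtopology Z (A \<inter> B))
      = euler_char (subtopology Z A) + euler_char (subtopology Z B)"
    using U(2) B(2) fin(2) ex(2) by (simp add: euler_char_eq_relative)
qed

text \<open>Induction on the index set, with the hypothesis used twice: for the sets
  \<open>W i\<close> and for their traces \<open>W i \<inter> W k\<close> on the new set. Here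
  \<open>P\<close> stands for the sets on which \<open>f\<close> is modular; in the application they
  are the open sets with finite homology.\<close>

lemma modular_inclusion_exclusion:
  fixes f :: "'a set \<Rightarrow> int" and W :: "'i \<Rightarrow> 'a set"
  assumes "P {}" "f {} = 0"
    and Un: "\<And>A B. P A \<Longrightarrow> P B \<Longrightarrow> P (A \<inter> B) \<Longrightarrow> P (A \<union> B)"
    and modular: "\<And>A B. P A \<Longrightarrow> P B \<Longrightarrow> P (A \<inter> B) \<Longrightarrow> f (A \<union> B) + f (A \<inter> B) = f A + f B"
    and "finite I" and "\<And>F. F \<subseteq> I \<Longrightarrow> F \<noteq> {} \<Longrightarrow> P (\<Inter>i\<in>F. W i)"
  shows "P (\<Union>i\<in>I. W i) \<and>
    f (\<Union>i\<in>I. W i) = (\<Sum>F | F \<subseteq> I \<and> F \<noteq> {}. (-1) ^ (card F + 1) * f (\<Inter>i\<in>F. W i))"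
  using assms(5,6)
proof (induction I arbitrary: W rule: finite_induct)
  case empty
  have "{F. F \<subseteq> {} \<and> F \<noteq> {}} = ({} :: 'i set set)" by auto
  then show ?case using assms(1,2) by (simp only: sum.empty) simp
next
  case (insert k I)
  define S where "S = {F. F \<subseteq> I \<and> F \<noteq> {}}"
  have finS: "finite S" unfolding S_def by (rule finite_subset[of _ "Pow I"]) (use insert in auto)
  have kS: "k \<notin> F" "finite F" if "F \<in> S" for F
    using that insert.hyps finite_subset by (auto simp: S_def)
  \<comment> \<open>For empty \<open>F\<close> the left side would be the whole type rather than
    \<open>W k\<close>.\<close>
  have Int_k: "(\<Inter>i\<in>F. W i \<inter> W k) = (\<Inter>i\<in>insert k F. W i)" if "F \<noteq> {}" for F
    using that by auto
  have 1: "P (\<Union>i\<in>I. W i) \<and>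
      f (\<Union>i\<in>I. W i) = (\<Sum>F\<in>S. (-1) ^ (card F + 1) * f (\<Inter>i\<in>F. W i))"
    unfolding S_def by (rule insert.IH) (use insert.prems in auto)
  have "P (\<Union>i\<in>I. W i \<inter> W k) \<and>
      f (\<Union>i\<in>I. W i \<inter> W k) = (\<Sum>F\<in>S. (-1) ^ (card F + 1) * f (\<Inter>i\<in>F. W i \<inter> W k))"
    unfolding S_def
  proof (rule insert.IH)
    fix F assume "F \<subseteq> I" "F \<noteq> {}"
    then show "P (\<Inter>i\<in>F. W i \<inter> W k)"
      by (subst Int_k) (assumption, rule insert.prems, auto)
  qed
  moreover have "(\<Union>i\<in>I. W i \<inter> W k) = (\<Union>i\<in>I. W i) \<inter> W k" by auto
  moreover have "(\<Sum>F\<in>S. (-1) ^ (card F + 1) * f (\<Inter>i\<in>F. W i \<inter> W k))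
      = (\<Sum>F\<in>S. (-1) ^ (card F + 1) * f (\<Inter>i\<in>insert k F. W i))"
    by (rule sum.cong[OF refl], subst Int_k) (auto simp: S_def)
  ultimately have 2: "P ((\<Union>i\<in>I. W i) \<inter> W k)"
    "f ((\<Union>i\<in>I. W i) \<inter> W k) = (\<Sum>F\<in>S. (-1) ^ (card F + 1) * f (\<Inter>i\<in>insert k F. W i))"
    by simp_all
  have k: "P (W k)" using insert.prems[of "{k}"] by simp
  have eq: "(\<Union>i\<in>insert k I. W i) = (\<Union>i\<in>I. W i) \<union> W k" by auto
  \<comment> \<open>Nonempty subsets of the enlarged index set either avoid \<open>k\<close>, equal
    \<open>{k}\<close>, or arise from a nonempty subset of \<open>I\<close> by inserting
    \<open>k\<close>.\<close>
  have subsets: "{F. F \<subseteq> insert k I \<and> F \<noteq> {}} = S \<union> insert {k} (insert k ` S)"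
  proof (intro equalityI subsetI)
    fix F assume F: "F \<in> {F. F \<subseteq> insert k I \<and> F \<noteq> {}}"
    show "F \<in> S \<union> insert {k} (insert k ` S)"
    proof (cases "k \<in> F \<and> F \<noteq> {k}")
      case True
      then have "F = insert k (F - {k})" "F - {k} \<in> S" using F by (auto simp: S_def)
      then show ?thesis by blast
    next
      case False
      then show ?thesis using F by (auto simp: S_def)
    qed
  qed (auto simp: S_def)
  have inj: "inj_on (insert k) S"
  proof (rule inj_onI)
    fix F G assume "F \<in> S" "G \<in> S" "insert k F = insert k G"
    then show "F = G" using kS(1)[of F] kS(1)[of G] by (simp add: insert_ident)
  qed
  have "(\<Sum>F | F \<subseteq> insert k I \<and> F \<noteq> {}. (-1) ^ (card F + 1) * f (\<Inter>i\<in>F. W i))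
    = (\<Sum>F\<in>S. (-1) ^ (card F + 1) * f (\<Inter>i\<in>F. W i))
      + (\<Sum>F\<in>insert {k} (insert k ` S). (-1) ^ (card F + 1) * f (\<Inter>i\<in>F. W i))"
    unfolding subsets by (rule sum.union_disjoint) (use finS kS in auto)
  also have "(\<Sum>F\<in>insert {k} (insert k ` S). (-1) ^ (card F + 1) * f (\<Inter>i\<in>F. W i))
    = f (W k) + (\<Sum>F\<in>insert k ` S. (-1) ^ (card F + 1) * f (\<Inter>i\<in>F. W i))"
  proof -
    have "{k} \<notin> insert k ` S" using kS(1) by (auto simp: S_def)
    then show ?thesis using finS by simp
  qed
  also have "(\<Sum>F\<in>insert k ` S. (-1) ^ (card F + 1) * f (\<Inter>i\<in>F. W i))
    = (\<Sum>F\<in>S. (-1) ^ (card (insert k F) + 1) * f (\<Inter>i\<in>insert k F. W i))"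
    by (simp only: sum.reindex[OF inj] comp_def)
  \<comment> \<open>Inserting \<open>k\<close> raises the cardinality by one and so flips the
    sign.\<close>
  also have "\<dots> = - (\<Sum>F\<in>S. (-1) ^ (card F + 1) * f (\<Inter>i\<in>insert k F. W i))"
    unfolding sum_negf[symmetric] by (rule sum.cong[OF refl]) (use kS in simp)
  finally have "(\<Sum>F | F \<subseteq> insert k I \<and> F \<noteq> {}. (-1) ^ (card F + 1) * f (\<Inter>i\<in>F. W i))
    = f (\<Union>i\<in>I. W i) + f (W k) - f ((\<Union>i\<in>I. W i) \<inter> W k)"
    using 1 2 by simp
  then show ?case
    unfolding eq using Un[OF conjunct1[OF 1] k 2(1)] modular[OF conjunct1[OF 1] k 2(1)] by simp
qed

text \<open>A nonempty intersection contributes 1 and an empty one 0, so inclusion-exclusion counts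
  the simplices of the nerve with sign; \<open>card F + 1\<close> has the parity of the dimension
  \<open>card F - 1\<close>.\<close>

lemma euler_char_good_cover:
  assumes "finite I" and W: "\<And>i. i \<in> I \<Longrightarrow> openin Z (W i)" "topspace Z = (\<Union>i\<in>I. W i)"
    and good: "\<And>F. F \<subseteq> I \<Longrightarrow> F \<noteq> {} \<Longrightarrow> (\<Inter>i\<in>F. W i) \<noteq> {} \<Longrightarrow>
      contractible_space (subtopology Z (\<Inter>i\<in>F. W i))"
  shows "euler_char Z =
    (\<Sum>F | F \<subseteq> I \<and> F \<noteq> {} \<and> (\<Inter>i\<in>F. W i) \<noteq> {}. (-1) ^ (card F + 1))"
proof -
  define P where "P = (\<lambda>A. openin Z A \<and> finite_homology (subtopology Z A) {})"
  define f where "f = (\<lambda>A. euler_char (subtopology Z A))"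
  have empty: "P {}" "f {} = 0"
    using finite_homology_empty[of "subtopology Z {}"]
    by (simp_all add: P_def f_def euler_char_eq_relative)
  have Int: "P (\<Inter>i\<in>F. W i)" "f (\<Inter>i\<in>F. W i) = (if (\<Inter>i\<in>F. W i) \<noteq> {} then 1 else 0)"
    if F: "F \<subseteq> I" "F \<noteq> {}" for F
  proof -
    have "openin Z (\<Inter>i\<in>F. W i)"
      using F W(1) finite_subset[OF F(1) assms(1)] by (intro openin_INT2) auto
    moreover from this have "topspace (subtopology Z (\<Inter>i\<in>F. W i)) = (\<Inter>i\<in>F. W i)"
      by (auto dest: openin_subset)
    ultimately have "P (\<Inter>i\<in>F. W i) \<and> f (\<Inter>i\<in>F. W i) = 1" if "(\<Inter>i\<in>F. W i) \<noteq> {}"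
      using finite_homology_contractible[OF good[OF F that]] that
      by (simp add: P_def f_def euler_char_eq_relative)
    then show "P (\<Inter>i\<in>F. W i)" "f (\<Inter>i\<in>F. W i) = (if (\<Inter>i\<in>F. W i) \<noteq> {} then 1 else 0)"
      using empty by (cases "(\<Inter>i\<in>F. W i) = {}"; simp)+
  qed
  have "f (\<Union>i\<in>I. W i) = (\<Sum>F | F \<subseteq> I \<and> F \<noteq> {}. (-1) ^ (card F + 1) * f (\<Inter>i\<in>F. W i))"
    by (rule conjunct2[OF modular_inclusion_exclusion[of P f, OF empty _ _ assms(1) Int(1)]])
      (auto simp: P_def f_def euler_char_open_Un)
  also have "\<dots> = (\<Sum>F | F \<subseteq> I \<and> F \<noteq> {}. if (\<Inter>i\<in>F. W i) \<noteq> {} then (-1) ^ (card F + 1) else 0)"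
    by (rule sum.cong[OF refl]) (use Int(2) in auto)
  also have "\<dots> = (\<Sum>F | (F \<subseteq> I \<and> F \<noteq> {}) \<and> (\<Inter>i\<in>F. W i) \<noteq> {}. (-1) ^ (card F + 1))"
    by (rule sum.inter_filter[symmetric, of "{F. F \<subseteq> I \<and> F \<noteq> {}}", simplified mem_Collect_eq])
      (use assms(1) in \<open>auto intro: finite_subset[of _ "Pow I"]\<close>)
  finally show ?thesis by (simp add: f_def flip: W(2))
qed

section \<open>Sublevel sets of a geometric complex\<close>

definition simplex_vertices :: "'a::euclidean_space set \<Rightarrow> 'a set" where
  "simplex_vertices \<Delta> = {x. x extreme_point_of \<Delta>}"

text \<open>A face is required to be nonempty because \<open>K\<close> itself may lack the empty
  simplex.\<close>

lemma geometric_complexD: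
  assumes K: "geometric_complex K"
  shows "finite K" "\<And>\<Delta>. \<Delta> \<in> K \<Longrightarrow> \<exists>n. n simplex \<Delta>"
    "\<And>F \<Delta>. \<Delta> \<in> K \<Longrightarrow> F face_of \<Delta> \<Longrightarrow> F \<noteq> {} \<Longrightarrow> F \<in> K"
    "\<And>\<Delta> \<Delta>'. \<Delta> \<in> K \<Longrightarrow> \<Delta>' \<in> K \<Longrightarrow> \<Delta> \<inter> \<Delta>' face_of \<Delta>"
  using K unfolding geometric_complex_def simplicial_complex_def by auto

text \<open>The affinely independent set that generates a simplex coincides with its set of extreme
  points, so facts about generators transfer to the vertices.\<close>

lemma simplex_vertices:
  assumes "n simplex \<Delta>"
  shows "finite (simplex_vertices \<Delta>)" "\<Delta> = convex hull simplex_vertices \<Delta>"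
    "int (card (simplex_vertices \<Delta>)) = aff_dim \<Delta> + 1"
    "\<And>F. F \<subseteq> simplex_vertices \<Delta> \<Longrightarrow> convex hull F face_of \<Delta>"
proof -
  obtain C where C: "finite C" "\<not> affine_dependent C" "int (card C) = n + 1" "\<Delta> = convex hull C"
    using assms by (auto simp: simplex)
  have eq: "simplex_vertices \<Delta> = C"
    using extreme_point_of_convex_hull_affine_independent[OF C(2)] C(4)
    by (auto simp: simplex_vertices_def)
  show "finite (simplex_vertices \<Delta>)" "\<Delta> = convex hull simplex_vertices \<Delta>"
    using C eq by simp_all
  show "int (card (simplex_vertices \<Delta>)) = aff_dim \<Delta> + 1"
    using C eq aff_dim_simplex[OF assms] by simp
  show "convex hull F face_of \<Delta>" if "F \<subseteq> simplex_vertices \<Delta>" for F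
    using face_of_convex_hull_affine_independent[OF C(2), of "convex hull F"] that C eq by auto
qed

lemma simplex_vertices_subset: "simplex_vertices \<Delta> \<subseteq> \<Delta>"
  by (auto simp: simplex_vertices_def extreme_point_of_def)

lemma vertex_set_eq: "vertex_set K = (\<Union>\<Delta>\<in>K. simplex_vertices \<Delta>)"
  by (auto simp: vertex_set_def simplex_vertices_def)

lemma linear_le_convex_hull_iff:
  "(\<forall>y\<in>convex hull F. y \<bullet> v \<le> t) \<longleftrightarrow> (\<forall>y\<in>F. y \<bullet> v \<le> t)"
proof
  assume "\<forall>y\<in>F. y \<bullet> v \<le> t"
  then have "convex hull F \<subseteq> {y. v \<bullet> y \<le> t}"
    by (intro hull_minimal convex_halfspace_le) (auto simp: inner_commute)
  then show "\<forall>y\<in>convex hull F. y \<bullet> v \<le> t" by (auto simp: inner_commute)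
qed (auto intro: hull_inc)

section \<open>Vertices of the complex and carriers of points\<close>

context
  fixes K :: "'a::euclidean_space set set"
  assumes K: "geometric_complex K"
begin

lemma finite_vertex_set: "finite (vertex_set K)"
  unfolding vertex_set_eq using geometric_complexD(1,2)[OF K] simplex_vertices(1) by blast

text \<open>A vertex \<open>x\<close> of any simplex of \<open>K\<close> gives a simplex
  \<open>{x}\<close> of \<open>K\<close>, and this meets \<open>\<Delta>\<close> in a face of
  \<open>\<Delta>\<close>.\<close>

lemma vertex_in_simplex_iff:
  assumes "x \<in> vertex_set K" "\<Delta> \<in> K"
  shows "x \<in> \<Delta> \<longleftrightarrow> x \<in> simplex_vertices \<Delta>"
proof
  assume x: "x \<in> \<Delta>"
  obtain \<Delta>' where \<Delta>': "\<Delta>' \<in> K" "{x} face_of \<Delta>'"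
    using assms(1) by (auto simp: vertex_set_def face_of_singleton)
  then have "{x} \<in> K" using geometric_complexD(3)[OF K] by blast
  then have "\<Delta> \<inter> {x} face_of \<Delta>" using geometric_complexD(4)[OF K] assms(2) by blast
  then show "x \<in> simplex_vertices \<Delta>" using x by (simp add: simplex_vertices_def face_of_singleton)
qed (use simplex_vertices_subset in blast)

lemma simplex_vertices_convex_hull:
  assumes "F \<subseteq> vertex_set K" "convex hull F \<in> K"
  shows "simplex_vertices (convex hull F) = F"
proof
  show "simplex_vertices (convex hull F) \<subseteq> F"
    by (auto simp: simplex_vertices_def extreme_point_of_convex_hull)
  show "F \<subseteq> simplex_vertices (convex hull F)"
    using assms vertex_in_simplex_iff[OF _ assms(2)] by (auto intro: hull_inc)
qed

text \<open>A minimal simplex containing \<open>y\<close> is the least one, because its intersection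
  with another simplex containing \<open>y\<close> is again a simplex of \<open>K\<close>.\<close>

lemma exists_carrier:
  assumes "y \<in> \<Union>K"
  obtains D where "D \<in> K" "y \<in> D" "\<And>\<Delta>. \<Delta> \<in> K \<Longrightarrow> y \<in> \<Delta> \<Longrightarrow> D \<subseteq> \<Delta>"
proof -
  let ?S = "{\<Delta>\<in>K. y \<in> \<Delta>}"
  have "finite ?S" "?S \<noteq> {}" using geometric_complexD(1)[OF K] assms by auto
  then obtain D where D: "D \<in> ?S" "\<And>\<Delta>. \<Delta> \<in> ?S \<Longrightarrow> \<Delta> \<subseteq> D \<Longrightarrow> D = \<Delta>"
    using finite_has_minimal[of ?S] by (metis (no_types, lifting))
  have "D \<subseteq> \<Delta>" if "\<Delta> \<in> K" "y \<in> \<Delta>" for \<Delta>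
  proof -
    have "D \<inter> \<Delta> \<in> K"
      using geometric_complexD(3,4)[OF K] D(1) that by blast
    then show ?thesis using D that by blast
  qed
  then show ?thesis using that D(1) by blast
qed

text \<open>The truncated open stars of the vertices at height at most \<open>t\<close> form a good
  cover, and its nerve consists of the vertex sets of the simplices lying wholly below
  \<open>t\<close>. Simplices that are cut by the level \<open>t\<close> leave no term.\<close>

lemma euler_char_sublevel:
  "euler_char (top_of_set {y \<in> \<Union>K. y \<bullet> v \<le> t}) =
    (\<Sum>\<Delta> | \<Delta> \<in> K \<and> \<Delta> \<noteq> {} \<and> (\<forall>y\<in>\<Delta>. y \<bullet> v \<le> t). (-1) ^ nat (aff_dim \<Delta>))"
proof -
  define Y where "Y = {y \<in> \<Union>K. y \<bullet> v \<le> t}"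
  define I where "I = {x \<in> vertex_set K. x \<bullet> v \<le> t}"
  \<comment> \<open>the open star of the vertex \<^term>\<open>x\<close>, cut off at height \<^term>\<open>t\<close>\<close>
  define W where "W = (\<lambda>x. {y \<in> Y. \<forall>\<Delta>\<in>K. y \<in> \<Delta> \<longrightarrow> x \<in> \<Delta>})"
  have finI: "finite I" using finite_vertex_set by (simp add: I_def)
  \<comment> \<open>The complement of the star in \<open>Y\<close> is cut out by finitely many
    closed simplices.\<close>
  have openW: "openin (top_of_set Y) (W x)" for x
  proof -
    have "closed (\<Union>{\<Delta>\<in>K. x \<notin> \<Delta>})"
      using geometric_complexD(1,2)[OF K] closed_simplex by (intro closed_Union) auto
    moreover have "W x = Y - \<Union>{\<Delta>\<in>K. x \<notin> \<Delta>}" by (auto simp: W_def)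
    ultimately show ?thesis by (auto simp: openin_closedin_eq closedin_closed)
  qed
  have cover: "topspace (top_of_set Y) = (\<Union>x\<in>I. W x)"
  proof
    show "topspace (top_of_set Y) \<subseteq> (\<Union>x\<in>I. W x)"
    proof
      fix y assume "y \<in> topspace (top_of_set Y)"
      then have y: "y \<in> Y" "y \<in> \<Union>K" "y \<bullet> v \<le> t" by (auto simp: Y_def)
      obtain D where D: "D \<in> K" "y \<in> D" "\<And>\<Delta>. \<Delta> \<in> K \<Longrightarrow> y \<in> \<Delta> \<Longrightarrow> D \<subseteq> \<Delta>"
        using exists_carrier[OF y(2)] by blast
      obtain n where "n simplex D" using geometric_complexD(2)[OF K D(1)] by blast
      note sv = simplex_vertices(2)[OF this]
      \<comment> \<open>If all vertices of the carrier were above \<open>t\<close>, then so would be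
        its hull, and with it \<open>y\<close>.\<close>
      have "\<exists>x\<in>simplex_vertices D. x \<bullet> v \<le> t"
      proof (rule ccontr)
        assume "\<not> (\<exists>x\<in>simplex_vertices D. x \<bullet> v \<le> t)"
        then have "simplex_vertices D \<subseteq> {y. v \<bullet> y > t}" by (auto simp: inner_commute)
        then have "convex hull simplex_vertices D \<subseteq> {y. v \<bullet> y > t}"
          by (intro hull_minimal convex_halfspace_gt)
        then have "v \<bullet> y > t" using D(2) sv by blast
        then show False using y(3) by (simp add: inner_commute)
      qed
      then obtain x where x: "x \<in> simplex_vertices D" "x \<bullet> v \<le> t" by blast
      then have "x \<in> I" using D(1) by (auto simp: I_def vertex_set_eq)
      moreover have "x \<in> \<Delta>" if "\<Delta> \<in> K" "y \<in> \<Delta>" for \<Delta>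
        using D(3)[OF that] x(1) simplex_vertices_subset by blast
      ultimately show "y \<in> (\<Union>x\<in>I. W x)" using y(1) by (auto simp: W_def)
    qed
  qed (auto simp: W_def)
  have W_Int: "(\<Inter>x\<in>F. W x) = {y \<in> Y. \<forall>\<Delta>\<in>K. y \<in> \<Delta> \<longrightarrow> F \<subseteq> \<Delta>}" if "F \<noteq> {}" for F
    using that by (auto simp: W_def)
  \<comment> \<open>A common point of the stars lies in a simplex that contains \<open>F\<close>,
    and the hull of \<open>F\<close> is a face of that simplex.\<close>
  have hull_in_K: "convex hull F \<in> K" if F: "F \<subseteq> I" "F \<noteq> {}" and ne: "(\<Inter>x\<in>F. W x) \<noteq> {}" for F
  proof -
    obtain y \<Delta> where \<Delta>: "\<Delta> \<in> K" "y \<in> \<Delta>" "F \<subseteq> \<Delta>"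
      using ne unfolding W_Int[OF F(2)] by (auto simp: Y_def)
    have "F \<subseteq> simplex_vertices \<Delta>"
      using vertex_in_simplex_iff[OF _ \<Delta>(1)] \<Delta>(3) F(1) by (auto simp: I_def)
    then have "convex hull F face_of \<Delta>"
      using simplex_vertices(4) geometric_complexD(2)[OF K \<Delta>(1)] by blast
    then show ?thesis using geometric_complexD(3)[OF K \<Delta>(1)] F(2) by simp
  qed
  have hull_Y: "convex hull F \<subseteq> {y. y \<bullet> v \<le> t}" if F: "F \<subseteq> I" for F
    using linear_le_convex_hull_iff[of F v t] F by (auto simp: I_def)
  have interior_point: "b \<in> (\<Inter>x\<in>F. W x)"
    if F: "F \<subseteq> I" "F \<noteq> {}" "convex hull F \<in> K" and b: "b \<in> rel_interior (convex hull F)" for F b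
  proof -
    have bF: "b \<in> convex hull F" using b rel_interior_subset by blast
    have "F \<subseteq> \<Delta>" if "\<Delta> \<in> K" "b \<in> \<Delta>" for \<Delta>
    proof -
      \<comment> \<open>A face of the simplex spanned by \<open>F\<close> that meets its relative
        interior is the whole simplex.\<close>
      have "convex hull F \<subseteq> convex hull F \<inter> \<Delta>"
        by (rule subset_of_face_of[OF geometric_complexD(4)[OF K F(3) that(1)]])
          (use b bF that in auto)
      then show ?thesis using hull_subset[of F convex] by (metis le_inf_iff subset_trans)
    qed
    then show ?thesis using hull_Y[OF F(1)] bF F(3) unfolding W_Int[OF F(2)] by (auto simp: Y_def)
  qed
  have star: "starlike (\<Inter>x\<in>F. W x)"
    if F: "F \<subseteq> I" "F \<noteq> {}" and ne: "(\<Inter>x\<in>F. W x) \<noteq> {}" for F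
  proof -
    note FK = hull_in_K[OF F ne]
    obtain b where b: "b \<in> rel_interior (convex hull F)"
      using F(2) rel_interior_eq_empty[of "convex hull F"] by auto
    have bW: "b \<in> (\<Inter>x\<in>F. W x)" by (rule interior_point[OF F FK b])
    have bF: "b \<in> convex hull F" using b rel_interior_subset by blast
    have "closed_segment b y \<subseteq> (\<Inter>x\<in>F. W x)" if yW: "y \<in> (\<Inter>x\<in>F. W x)" for y
    proof
      fix z assume z: "z \<in> closed_segment b y"
      obtain \<Delta> where \<Delta>: "\<Delta> \<in> K" "y \<in> \<Delta>" "F \<subseteq> \<Delta>" and yt: "y \<bullet> v \<le> t"
        using yW unfolding W_Int[OF F(2)] by (auto simp: Y_def)
      have conv: "convex \<Delta>" using geometric_complexD(2)[OF K \<Delta>(1)] convex_simplex by blast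
      then have b\<Delta>: "b \<in> \<Delta>" using bF \<Delta>(3) hull_minimal by blast
      have "closed_segment b y \<subseteq> \<Delta>" using conv b\<Delta> \<Delta>(2) by (simp add: closed_segment_subset)
      moreover have "closed_segment b y \<subseteq> {y. v \<bullet> y \<le> t}"
        using yt bF hull_Y[OF F(1)] closed_segment_subset[OF _ _ convex_halfspace_le[of v t], of b y]
        by (auto simp: inner_commute)
      ultimately have zY: "z \<in> Y" "z \<in> \<Delta>" using z \<Delta>(1) by (auto simp: Y_def inner_commute)
      show "z \<in> (\<Inter>x\<in>F. W x)"
      proof (cases "z = b \<or> z = y")
        case True
        then show ?thesis using bW yW by blast
      next
        case False
        then have oz: "z \<in> open_segment b y" using z by (auto simp: open_segment_def)
        have "F \<subseteq> \<Delta>'" if "\<Delta>' \<in> K" "z \<in> \<Delta>'" for \<Delta>'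
        proof -
          \<comment> \<open>A face containing an interior point of a segment in
            \<open>\<Delta>\<close> contains both endpoints. Hence \<open>y\<close> lies in
            \<open>\<Delta>'\<close>, and every simplex containing \<open>y\<close> contains
            \<open>F\<close>.\<close>
          have "\<Delta> \<inter> \<Delta>' face_of \<Delta>" using geometric_complexD(4)[OF K \<Delta>(1) that(1)] .
          then have "y \<in> \<Delta>'"
            using b\<Delta> \<Delta>(2) oz zY(2) that(2) unfolding face_of_def by blast
          then show ?thesis using yW that(1) unfolding W_Int[OF F(2)] by blast
        qed
        then show ?thesis using zY(1) unfolding W_Int[OF F(2)] by blast
      qed
    qed
    then show ?thesis unfolding starlike_def using bW by blast
  qed
  have contr: "contractible_space (subtopology (top_of_set Y) (\<Inter>x\<in>F. W x))"
    if F: "F \<subseteq> I" "F \<noteq> {}" and ne: "(\<Inter>x\<in>F. W x) \<noteq> {}" for F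
  proof -
    have "(\<Inter>x\<in>F. W x) \<subseteq> Y" using W_Int[OF F(2)] by auto
    then show ?thesis
      using starlike_imp_contractible[OF star[OF F ne]]
      by (simp add: subtopology_subtopology Int_absorb1)
  qed
  let ?\<F> = "{F. F \<subseteq> I \<and> F \<noteq> {} \<and> (\<Inter>x\<in>F. W x) \<noteq> {}}"
  let ?\<D> = "{\<Delta>. \<Delta> \<in> K \<and> \<Delta> \<noteq> {} \<and> (\<forall>y\<in>\<Delta>. y \<bullet> v \<le> t)}"
  have \<F>: "?\<F> = {F. F \<subseteq> I \<and> F \<noteq> {} \<and> convex hull F \<in> K}"
  proof -
    have "(\<Inter>x\<in>F. W x) \<noteq> {}" if F: "F \<subseteq> I" "F \<noteq> {}" "convex hull F \<in> K" for F
    proof -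
      obtain b where "b \<in> rel_interior (convex hull F)"
        using F(2) rel_interior_eq_empty[of "convex hull F"] by auto
      then show ?thesis using interior_point[OF F] by blast
    qed
    then show ?thesis using hull_in_K by auto
  qed
  have "euler_char (top_of_set Y) = (\<Sum>F\<in>?\<F>. (-1) ^ (card F + 1))"
    by (rule euler_char_good_cover[OF finI openW cover contr])
  also have "\<dots> = (\<Sum>\<Delta>\<in>?\<D>. (-1) ^ nat (aff_dim \<Delta>))"
    unfolding \<F>
  proof (rule sum.reindex_bij_witness[where j = "\<lambda>F. convex hull F" and i = simplex_vertices])
    fix F assume "F \<in> {F. F \<subseteq> I \<and> F \<noteq> {} \<and> convex hull F \<in> K}"
    then have F: "F \<subseteq> I" "F \<noteq> {}" "convex hull F \<in> K" by auto
    then have FK: "F \<subseteq> vertex_set K" by (auto simp: I_def)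
    show eq: "simplex_vertices (convex hull F) = F"
      by (rule simplex_vertices_convex_hull[OF FK F(3)])
    show "convex hull F \<in> ?\<D>" using F hull_Y[OF F(1)] by auto
    obtain n where "n simplex convex hull F" using geometric_complexD(2)[OF K F(3)] by blast
    then have card: "int (card F) = aff_dim (convex hull F) + 1"
      using simplex_vertices(3) eq by fastforce
    moreover have "card F > 0" using F finI finite_subset card_gt_0_iff by blast
    \<comment> \<open>The exponents differ by exactly 2; nonemptiness of \<open>F\<close> makes the
      dimension nonnegative, so \<open>nat\<close> does not truncate.\<close>
    ultimately have "card F + 1 = nat (aff_dim (convex hull F)) + 2" by linarith
    then show "(-1) ^ nat (aff_dim (convex hull F)) = (-1::int) ^ (card F + 1)"
      by (simp add: power_add)
  next
    fix \<Delta> assume "\<Delta> \<in> ?\<D>"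
    then have \<Delta>: "\<Delta> \<in> K" "\<Delta> \<noteq> {}" "\<forall>y\<in>\<Delta>. y \<bullet> v \<le> t" by auto
    obtain n where "n simplex \<Delta>" using geometric_complexD(2)[OF K \<Delta>(1)] by blast
    then show eq: "convex hull simplex_vertices \<Delta> = \<Delta>" using simplex_vertices(2) by metis
    then have "simplex_vertices \<Delta> \<noteq> {}" using \<Delta>(2) by auto
    moreover have "simplex_vertices \<Delta> \<subseteq> I"
      using \<Delta>(1,3) simplex_vertices_subset by (auto simp: I_def vertex_set_eq)
    ultimately show "simplex_vertices \<Delta> \<in> {F. F \<subseteq> I \<and> F \<noteq> {} \<and> convex hull F \<in> K}"
      using eq \<Delta>(1) by simp
  qed
  finally show ?thesis unfolding Y_def .
qed

section \<open>Lower stars in generic directions\<close>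

lemma lower_star_iff:
  "\<Delta> \<in> lower_star K x v \<longleftrightarrow>
    \<Delta> \<in> K \<and> x \<in> simplex_vertices \<Delta> \<and> (\<forall>y\<in>simplex_vertices \<Delta>. y \<bullet> v \<le> x \<bullet> v)"
proof -
  have "(\<forall>y\<in>\<Delta>. y \<bullet> v \<le> x \<bullet> v) \<longleftrightarrow> (\<forall>y\<in>simplex_vertices \<Delta>. y \<bullet> v \<le> x \<bullet> v)"
    if \<Delta>: "\<Delta> \<in> K"
  proof -
    obtain n where "n simplex \<Delta>" using geometric_complexD(2)[OF K \<Delta>] by blast
    then show ?thesis
      using linear_le_convex_hull_iff[of "simplex_vertices \<Delta>" v "x \<bullet> v"] simplex_vertices(2) by metis
  qed
  then show ?thesis by (auto simp: lower_star_def simplex_vertices_def)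
qed

text \<open>If \<open>y\<close> overtook \<open>x\<close> between \<open>v\<close> and
  \<open>w\<close>, the intermediate value theorem on the connected set \<open>U\<close> would yield
  a direction in which \<open>x\<close> and \<open>y\<close> tie. Inclusion suffices, since
  \<open>v\<close> and \<open>w\<close> may be exchanged.\<close>

lemma lower_star_subset_connected:
  assumes U: "U \<subseteq> generic_directions (vertex_set K)" "connected U" and vw: "v \<in> U" "w \<in> U"
  shows "lower_star K x v \<subseteq> lower_star K x w"
proof
  fix \<Delta> assume "\<Delta> \<in> lower_star K x v"
  then have \<Delta>: "\<Delta> \<in> K" "x \<in> simplex_vertices \<Delta>" "\<forall>y\<in>simplex_vertices \<Delta>. y \<bullet> v \<le> x \<bullet> v"
    by (auto simp: lower_star_iff)
  have "y \<bullet> w \<le> x \<bullet> w" if y: "y \<in> simplex_vertices \<Delta>" for y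
  proof (rule ccontr)
    assume "\<not> y \<bullet> w \<le> x \<bullet> w"
    then have w: "0 \<le> (y - x) \<bullet> w" "x \<noteq> y" by (auto simp: inner_diff_left)
    have v: "(y - x) \<bullet> v \<le> 0" using \<Delta>(3) y by (simp add: inner_diff_left)
    have "\<exists>u\<in>U. (y - x) \<bullet> u = 0"
      by (rule connected_ivt_hyperplane[OF U(2) vw]) (use v w in auto)
    then obtain u where u: "u \<in> U" "x \<bullet> u = y \<bullet> u" by (auto simp: inner_diff_left)
    have "x \<in> vertex_set K" "y \<in> vertex_set K" using \<Delta>(1,2) y by (auto simp: vertex_set_eq)
    then have "u \<in> tie_directions (vertex_set K)"
      using u(2) w(2) by (auto simp: tie_directions_def)
    then show False using u(1) U(1) by (auto simp: generic_directions_def)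
  qed
  then show "\<Delta> \<in> lower_star K x w" using \<Delta> by (simp add: lower_star_iff)
qed

lemma ECT_eq_sum_lower_stars:
  assumes v: "v \<in> generic_directions (vertex_set K)"
  shows "ECT K v t =
    (\<Sum>x\<in>vertex_set K. indicator {v \<bullet> x..} t * simplex_euler_char (lower_star K x v))"
proof -
  let ?I = "{x \<in> vertex_set K. x \<bullet> v \<le> t}"
  let ?\<D> = "{\<Delta>. \<Delta> \<in> K \<and> \<Delta> \<noteq> {} \<and> (\<forall>y\<in>\<Delta>. y \<bullet> v \<le> t)}"
  \<comment> \<open>Each simplex below \<open>t\<close> belongs to the lower star of a highest
    vertex, and the height of that vertex bounds the whole simplex.\<close>
  have "?\<D> = (\<Union>x\<in>?I. lower_star K x v)"
  proof (intro equalityI subsetI)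
    fix \<Delta> assume "\<Delta> \<in> ?\<D>"
    then have \<Delta>: "\<Delta> \<in> K" "\<Delta> \<noteq> {}" "\<forall>y\<in>\<Delta>. y \<bullet> v \<le> t" by auto
    obtain n where n: "n simplex \<Delta>" using geometric_complexD(2)[OF K \<Delta>(1)] by blast
    have "finite (simplex_vertices \<Delta>)" "simplex_vertices \<Delta> \<noteq> {}"
      using simplex_vertices(1,2)[OF n] \<Delta>(2) by auto
    then obtain x where x: "x \<in> simplex_vertices \<Delta>"
      "\<And>y. y \<in> simplex_vertices \<Delta> \<Longrightarrow> y \<bullet> v \<le> x \<bullet> v"
      using obtains_MAX[of "simplex_vertices \<Delta>" "\<lambda>x. x \<bullet> v"]
      by (metis Max_ge finite_imageI imageI)
    then have "\<Delta> \<in> lower_star K x v" using \<Delta>(1) by (simp add: lower_star_iff)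
    moreover have "x \<in> ?I" using x(1) \<Delta>(1,3) simplex_vertices_subset by (auto simp: vertex_set_eq)
    ultimately show "\<Delta> \<in> (\<Union>x\<in>?I. lower_star K x v)" by blast
  next
    fix \<Delta> assume "\<Delta> \<in> (\<Union>x\<in>?I. lower_star K x v)"
    then show "\<Delta> \<in> ?\<D>"
      by (auto simp: lower_star_def extreme_point_of_def intro: order_trans)
  qed
  moreover have "(\<Sum>\<Delta>\<in>(\<Union>x\<in>?I. lower_star K x v). (-1) ^ nat (aff_dim \<Delta>))
    = (\<Sum>x\<in>?I. simplex_euler_char (lower_star K x v))"
    unfolding simplex_euler_char_def
  proof (rule sum.UNION_disjoint)
    show "finite ?I" using finite_vertex_set by simp
    show "\<forall>x\<in>?I. finite (lower_star K x v)"
      using geometric_complexD(1)[OF K] by (simp add: lower_star_def)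
    \<comment> \<open>Two highest vertices of one simplex would tie, which genericity of
      \<open>v\<close> forbids; so the lower stars are disjoint.\<close>
    have "x = y" if "x \<in> vertex_set K" "y \<in> vertex_set K" "\<Delta> \<in> lower_star K x v" "\<Delta> \<in> lower_star K y v"
      for x y \<Delta>
    proof (rule ccontr)
      assume "x \<noteq> y"
      moreover have "x \<bullet> v = y \<bullet> v" using that(3,4) by (auto simp: lower_star_iff intro: antisym)
      ultimately have "v \<in> tie_directions (vertex_set K)"
        using that(1,2) by (auto simp: tie_directions_def)
      then show False using v by (simp add: generic_directions_def)
    qed
    then show "\<forall>x\<in>?I. \<forall>y\<in>?I. x \<noteq> y \<longrightarrow> lower_star K x v \<inter> lower_star K y v = {}" by blast
  qed
  ultimately have "ECT K v t = (\<Sum>x\<in>?I. simplex_euler_char (lower_star K x v))"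
    unfolding ECT_def euler_char_sublevel by simp
  also have "\<dots> = (\<Sum>x\<in>vertex_set K. indicator {v \<bullet> x..} t * simplex_euler_char (lower_star K x v))"
    using finite_vertex_set
    by (intro sum.mono_neutral_cong_left) (auto simp: indicator_def inner_commute)
  finally show ?thesis .
qed

end

theorem lemma5p19:
  fixes K :: "(real ^ 'd) set set" and U :: "(real ^ 'd) set"
  assumes "geometric_complex K"
    and "U \<subseteq> generic_directions (vertex_set K)"
    and "connected U"
  shows "(\<forall>x\<in>vertex_set K. \<forall>v\<in>U. \<forall>w\<in>U. lower_star K x v = lower_star K x w) \<and>
    (\<forall>v\<in>U. ECT K v =
      (\<lambda>t. \<Sum>x\<in>vertex_set K. indicator {v \<bullet> x..} t * simplex_euler_char (lower_star_on K x U)))"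
proof -
  have const: "lower_star K x v = lower_star K x w" if "v \<in> U" "w \<in> U" for x v w
    using lower_star_subset_connected[OF assms] that by blast
  have on: "lower_star_on K x U = lower_star K x v" if v: "v \<in> U" for x v
    unfolding lower_star_on_def
  \<comment> \<open>The given \<open>v\<close> shows that \<open>U\<close> is nonempty, so that only
    one set can be the common value.\<close>
  proof (rule the_equality)
    show "\<forall>w\<in>U. lower_star K x w = lower_star K x v" using const v by blast
  qed (use v in blast)
  have "ECT K v t =
      (\<Sum>x\<in>vertex_set K. indicator {v \<bullet> x..} t * simplex_euler_char (lower_star_on K x U))"
    if "v \<in> U" for v t
    using ECT_eq_sum_lower_stars[OF assms(1) subsetD[OF assms(2) that]] by (simp add: on[OF that])
  then show ?thesis using const by blast
qed

end
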